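(* Let $A$ and $Q$ be word automatic abelian groups, with given FA presentations. Let $L$ be a central extension of $Q$ by $A$, given by an exact sequence $0\to A\to L\to Q\to 0$ with (the image of) $A$ contained in the centre $Z(L)$. Suppose that some cocycle $f:Q\times Q\to A$ describing this extension is FA-recognizable (with respect to the given FA presentations of $Q$ and $A$). Then $L$ is word automatic.
   Context: Convolution: let $\Sigma$ be a finite alphabet and $\Diamond\notin\Sigma$ a filler symbol. For $\sigma_1,\dots,\sigma_n\in\Sigma^*$, extend each string on the right by symbols $\Diamond$ to the common length $\max_i|\sigma_i|$, and stack the resulting strings on top of each other to obtain a single string over the alphabet $(\Sigma\cup\{\Diamond\})^n$. A relation $S\subseteq(\Sigma^* )^n$ is FA-recognizable if the set of convolutions of its tuples is a regular language over $(\Sigma\cup\{\Diamond\})^n$. Word automatic: a group $G$ is word automatic (FA-presentable) if it has an FA presentation, i.e. there are a finite alphabet $\Sigma$, a regular language $D\subseteq\Sigma^*$ and a surjection $\pi:D\to G$ (elements may be represented by more than one string) such that the relations $\{(\sigma,\tau)\in D^2:\pi(\sigma)=\pi(\tau)\}$ and $\{(\sigma,\tau,\rho)\in D^3:\pi(\sigma)\pi(\tau)=\pi(\rho)\}$ are FA-recognizable. (This is not the notion of automatic group in the sense of Thurston and Epstein.) Cocycles: for abelian groups $Q,A$ (written additively), a cocycle is a function $f:Q\times Q\to A$ with $f(u,v)+f(u+v,w)=f(v,w)+f(u,v+w)$ for all $u,v,w\in Q$. It defines a group $L_f$ on the set $Q\times A$ with operation $(u,a)\cdot(v,b)=(u+v,\,a+b+f(u,v))$.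 A cocycle $f$ describes the central extension $0\to A\to L\to Q\to 0$ if there is a choice of coset representatives $q\mapsto\overline q\in L$ (with $\overline q$ mapping to $q$ under $L\to Q$) such that $f(q_0,q_1)=\overline{q_0}\cdot\overline{q_1}\cdot(\overline{q_0+q_1})^{-1}$ for all $q_0,q_1\in Q$, where $A$ is identified with its image in $L$; in this case $L\cong L_f$. FA-recognizability of $f$: given FA presentations $\pi_Q:D_Q\to Q$ and $\pi_A:D_A\to A$ (with both alphabets regarded as subsets of a common finite alphabet), $f$ is FA-recognizable if the relation $\{(\sigma,\tau,\rho)\in D_Q\times D_Q\times D_A: f(\pi_Q(\sigma),\pi_Q(\tau))=\pi_A(\rho)\}$ is FA-recognizable. *)

theory Defs
  imports "HOL-Algebra.Algebra"
begin

(* Regularity is recognition by a deterministic finite automaton. States are natural numbers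
   without loss of generality; delta only matters on K x Sigma. *)
definition regular_language :: "'s set \<Rightarrow> 's list set \<Rightarrow> bool" where
  "regular_language \<Sigma> W \<longleftrightarrow>
     finite \<Sigma> \<and>
     (\<exists>(K :: nat set) q0 F \<delta>.
        finite K \<and> q0 \<in> K \<and> F \<subseteq> K \<and> (\<forall>q\<in>K. \<forall>a\<in>\<Sigma>. \<delta> q a \<in> K) \<and>
        W = {w \<in> lists \<Sigma>. foldl \<delta> q0 w \<in> F})"

(* The filler symbol is None; a proper letter a appears as Some a. An n-tuple of strings is a
   list of length n, and a letter of the convolution is a list of length n over 's option. *)
definition convolution :: "'s list list \<Rightarrow> 's option list list" where
  "convolution ws =
     map (\<lambda>i. map (\<lambda>w. if i < length w then Some (w ! i) else None) ws)
       [0..<Max (insert 0 (length ` set ws))]"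

definition conv_alphabet :: "'s set \<Rightarrow> nat \<Rightarrow> 's option list set" where
  "conv_alphabet \<Sigma> n = {c. length c = n \<and> set c \<subseteq> insert None (Some ` \<Sigma>)}"

definition fa_recognizable :: "'s set \<Rightarrow> nat \<Rightarrow> 's list list set \<Rightarrow> bool" where
  "fa_recognizable \<Sigma> n S \<longleftrightarrow>
     finite \<Sigma> \<and>
     S \<subseteq> {ws. length ws = n \<and> set ws \<subseteq> lists \<Sigma>} \<and>
     regular_language (conv_alphabet \<Sigma> n) (convolution ` S)"

definition fa_presentation ::
  "'s set \<Rightarrow> 's list set \<Rightarrow> ('s list \<Rightarrow> 'g) \<Rightarrow> ('g, 'm) monoid_scheme \<Rightarrow> bool" where
  "fa_presentation \<Sigma> D \<pi> G \<longleftrightarrow>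
     finite \<Sigma> \<and>
     regular_language \<Sigma> D \<and>
     \<pi> ` D = carrier G \<and>
     fa_recognizable \<Sigma> 2 {[\<sigma>, \<tau>] | \<sigma> \<tau>. \<sigma> \<in> D \<and> \<tau> \<in> D \<and> \<pi> \<sigma> = \<pi> \<tau>} \<and>
     fa_recognizable \<Sigma> 3
       {[\<sigma>, \<tau>, \<rho>] | \<sigma> \<tau> \<rho>. \<sigma> \<in> D \<and> \<tau> \<in> D \<and> \<rho> \<in> D \<and> \<pi> \<sigma> \<otimes>\<^bsub>G\<^esub> \<pi> \<tau> = \<pi> \<rho>}"

(* Types cannot be quantified existentially; since every finite alphabet can be renamed to a
   finite set of natural numbers, quantifying over such sets covers all finite alphabets. *)
definition word_automatic :: "('g, 'm) monoid_scheme \<Rightarrow> bool" where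
  "word_automatic G \<longleftrightarrow>
     group G \<and> (\<exists>(\<Sigma> :: nat set) D \<pi>. fa_presentation \<Sigma> D \<pi> G)"

(* The exact sequence 0 -> A -> L -> Q -> 0 with maps \<iota>, \<phi> and \<iota>(A) contained in Z(L). The library's
   short_exact_sequence is not used because it forces A, L and Q to have the same type. *)
definition central_extension ::
  "('a, 'm) monoid_scheme \<Rightarrow> ('l, 'n) monoid_scheme \<Rightarrow> ('q, 'k) monoid_scheme
   \<Rightarrow> ('a \<Rightarrow> 'l) \<Rightarrow> ('l \<Rightarrow> 'q) \<Rightarrow> bool" where
  "central_extension A L Q \<iota> \<phi> \<longleftrightarrow>
     group A \<and> group L \<and> group Q \<and>
     \<iota> \<in> mon A L \<and> \<phi> \<in> epi L Q \<and> \<iota> ` carrier A = kernel L Q \<phi> \<and>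
     \<iota> ` carrier A \<subseteq> {z \<in> carrier L. \<forall>x\<in>carrier L. z \<otimes>\<^bsub>L\<^esub> x = x \<otimes>\<^bsub>L\<^esub> z}"

(* The groups A and Q, additive in the mathematical literature, are written multiplicatively. *)
definition cocycle ::
  "('q, 'k) monoid_scheme \<Rightarrow> ('a, 'm) monoid_scheme \<Rightarrow> ('q \<Rightarrow> 'q \<Rightarrow> 'a) \<Rightarrow> bool" where
  "cocycle Q A f \<longleftrightarrow>
     (\<forall>u\<in>carrier Q. \<forall>v\<in>carrier Q. f u v \<in> carrier A) \<and>
     (\<forall>u\<in>carrier Q. \<forall>v\<in>carrier Q. \<forall>w\<in>carrier Q.
        f u v \<otimes>\<^bsub>A\<^esub> f (u \<otimes>\<^bsub>Q\<^esub> v) w = f v w \<otimes>\<^bsub>A\<^esub> f u (v \<otimes>\<^bsub>Q\<^esub> w))"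

definition cocycle_describes ::
  "('a, 'm) monoid_scheme \<Rightarrow> ('l, 'n) monoid_scheme \<Rightarrow> ('q, 'k) monoid_scheme
   \<Rightarrow> ('a \<Rightarrow> 'l) \<Rightarrow> ('l \<Rightarrow> 'q) \<Rightarrow> ('q \<Rightarrow> 'q \<Rightarrow> 'a) \<Rightarrow> bool" where
  "cocycle_describes A L Q \<iota> \<phi> f \<longleftrightarrow>
     cocycle Q A f \<and>
     (\<exists>r. (\<forall>q\<in>carrier Q. r q \<in> carrier L \<and> \<phi> (r q) = q) \<and>
          (\<forall>q0\<in>carrier Q. \<forall>q1\<in>carrier Q.
             \<iota> (f q0 q1) = r q0 \<otimes>\<^bsub>L\<^esub> r q1 \<otimes>\<^bsub>L\<^esub> inv\<^bsub>L\<^esub> (r (q0 \<otimes>\<^bsub>Q\<^esub> q1))))"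

definition fa_recognizable_cocycle ::
  "'s set \<Rightarrow> 's list set \<Rightarrow> ('s list \<Rightarrow> 'q) \<Rightarrow> 's list set \<Rightarrow> ('s list \<Rightarrow> 'a)
   \<Rightarrow> ('q \<Rightarrow> 'q \<Rightarrow> 'a) \<Rightarrow> bool" where
  "fa_recognizable_cocycle \<Sigma> D\<^sub>Q \<pi>\<^sub>Q D\<^sub>A \<pi>\<^sub>A f \<longleftrightarrow>
     fa_recognizable \<Sigma> 3
       {[\<sigma>, \<tau>, \<rho>] | \<sigma> \<tau> \<rho>. \<sigma> \<in> D\<^sub>Q \<and> \<tau> \<in> D\<^sub>Q \<and> \<rho> \<in> D\<^sub>A \<and> f (\<pi>\<^sub>Q \<sigma>) (\<pi>\<^sub>Q \<tau>) = \<pi>\<^sub>A \<rho>}"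

end

theory Submission
  imports Defs
begin

text \<open>The elements of the extension are the products of a coset representative and a central element,
  so a pair of strings for \<open>Q\<close> and \<open>A\<close>, stacked as one convolution, names an element. Equality
  and multiplication of such elements are first-order definable from the given recognizable
  relations, the cocycle entering the multiplication through an existentially quantified string
  for its value. Closure of regularity under the operations involved is read off the
  Myhill--Nerode criterion; existential quantification may leave trailing fillers, which are
  removed by a right quotient.\<close>

text \<open>Selecting or deleting tracks is a letterwise map, but it may remove the longest string
  and so send a convolution to a convolution followed by columns of fillers. The closure arguments
  for relations therefore run on \<open>padded S\<close>, which contains every sufficiently long
  padding of every tuple: there track selection commutes with padding, and intersections are
  preserved because padding is injective. The return to exact convolutions happens only once a whole
  relation has been assembled. Counting residuals instead of building automata keeps alphabets out
  of the closure properties: a language over an infinite letter type may have finitely many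
  residuals, as the set of all paddings does, and a finite alphabet enters only when an automaton is
  wanted.\<close>

section \<open>Residuals and the Myhill-Nerode criterion\<close>

definition residual :: "'c list set \<Rightarrow> 'c list \<Rightarrow> 'c list set" where
  "residual W w = {u. w @ u \<in> W}"

definition finite_residuals :: "'c list set \<Rightarrow> bool" where
  "finite_residuals W \<longleftrightarrow> finite (range (residual W))"

lemma finite_residuals_subset:
  assumes "finite Z" and "\<And>w. residual W w \<in> Z"
  shows "finite_residuals W"
  unfolding finite_residuals_def using assms by (auto intro: finite_subset)

text \<open>The residual of a word over \<Sigma> is the language accepted from the state it reaches;
  the extra \<open>{}\<close> accounts for words with a letter outside \<Sigma>.\<close>

lemma regular_language_finite_residuals:
  assumes "regular_language \<Sigma> W"
  shows "finite_residuals W"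
proof -
  obtain K :: "nat set" and q0 F \<delta> where K: "finite K" "q0 \<in> K"
    and step: "\<And>q a. q \<in> K \<Longrightarrow> a \<in> \<Sigma> \<Longrightarrow> \<delta> q a \<in> K"
    and W: "W = {w \<in> lists \<Sigma>. foldl \<delta> q0 w \<in> F}"
    using assms unfolding regular_language_def by blast
  have run: "foldl \<delta> q w \<in> K" if "w \<in> lists \<Sigma>" "q \<in> K" for w q
    using that by (induction w arbitrary: q) (auto simp: step)
  let ?Z = "insert {} ((\<lambda>q. {u \<in> lists \<Sigma>. foldl \<delta> q u \<in> F}) ` K)"
  show ?thesis
  proof (rule finite_residuals_subset)
    show "finite ?Z" using K by simp
    fix w
    show "residual W w \<in> ?Z"
    proof (cases "w \<in> lists \<Sigma>")
      case True
      then have "residual W w = {u \<in> lists \<Sigma>. foldl \<delta> (foldl \<delta> q0 w) u \<in> F}"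
        unfolding residual_def W by auto
      then show ?thesis using run[OF True K(2)] by blast
    next
      case False
      then have "residual W w = {}" unfolding residual_def W by auto
      then show ?thesis by simp
    qed
  qed
qed

text \<open>The minimal automaton: states are residuals, reading \<open>a\<close> takes the
  derivative by \<open>a\<close>, and a state accepts if it contains the empty word. The injection
  \<open>e\<close> renames residuals as natural numbers.\<close>

lemma finite_residuals_regular_language:
  assumes "finite \<Sigma>" and "W \<subseteq> lists \<Sigma>" and "finite_residuals W"
  shows "regular_language \<Sigma> W"
proof -
  define Z where "Z = range (residual W)"
  have "finite Z" using assms(3) by (simp add: Z_def finite_residuals_def)
  then obtain e :: "'a list set \<Rightarrow> nat" where e: "inj_on e Z"
    using finite_imp_inj_to_nat_seg by metis
  define \<delta> where "\<delta> q a = e {u. a # u \<in> inv_into Z e q}" for q a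
  have \<delta>: "\<delta> (e (residual W w)) a = e (residual W (w @ [a]))" for w a
  proof -
    have "inv_into Z e (e (residual W w)) = residual W w"
      by (rule inv_into_f_f[OF e]) (simp add: Z_def)
    moreover have "{u. a # u \<in> residual W w} = residual W (w @ [a])" by (simp add: residual_def)
    ultimately show ?thesis by (simp only: \<delta>_def)
  qed
  have run: "foldl \<delta> (e (residual W w)) u = e (residual W (w @ u))" for w u
    by (induction u arbitrary: w) (simp_all add: \<delta>)
  define F where "F = e ` {Y \<in> Z. [] \<in> Y}"
  have F: "e (residual W w) \<in> F \<longleftrightarrow> w \<in> W" for w
  proof -
    have "e (residual W w) \<in> F \<longleftrightarrow> residual W w \<in> {Y \<in> Z. [] \<in> Y}"
      unfolding F_def by (rule inj_on_image_mem_iff[OF e]) (auto simp: Z_def)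
    then show ?thesis by (simp add: Z_def residual_def)
  qed
  have "W = {w \<in> lists \<Sigma>. foldl \<delta> (e (residual W [])) w \<in> F}"
    unfolding run using F assms(2) by auto
  moreover have "\<forall>q\<in>e ` Z. \<forall>a\<in>\<Sigma>. \<delta> q a \<in> e ` Z"
    by (auto simp: Z_def \<delta>)
  moreover have "e (residual W []) \<in> e ` Z" "F \<subseteq> e ` Z" by (auto simp: Z_def F_def)
  ultimately show ?thesis
    unfolding regular_language_def using assms(1) \<open>finite Z\<close>
    by (intro conjI exI[of _ "e ` Z"] exI[of _ "e (residual W [])"] exI[of _ F] exI[of _ \<delta>])
      simp_all
qed

section \<open>Closure properties of languages with finitely many residuals\<close>

lemma finite_residuals_Int:
  assumes "finite_residuals V" and "finite_residuals W"
  shows "finite_residuals (V \<inter> W)"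
proof (rule finite_residuals_subset)
  show "finite ((\<lambda>(Z, Y). Z \<inter> Y) ` (range (residual V) \<times> range (residual W)))"
    using assms by (simp add: finite_residuals_def)
  fix w
  have "residual (V \<inter> W) w = residual V w \<inter> residual W w" by (auto simp: residual_def)
  then show "residual (V \<inter> W) w \<in>
      (\<lambda>(Z, Y). Z \<inter> Y) ` (range (residual V) \<times> range (residual W))" by auto
qed

lemma finite_residuals_lists: "finite_residuals (lists C)"
proof (rule finite_residuals_subset)
  show "finite {{}, lists C}" by simp
  show "residual (lists C) w \<in> {{}, lists C}" for w
    by (cases "w \<in> lists C") (auto simp: residual_def)
qed

lemma finite_residuals_INT:
  assumes "finite J" and "\<And>j. j \<in> J \<Longrightarrow> finite_residuals (W j)"
  shows "finite_residuals (\<Inter>j\<in>J. W j)"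
  using assms
proof (induction J rule: finite_induct)
  case empty
  show ?case using finite_residuals_lists[of UNIV] by simp
next
  case (insert j J)
  then show ?case by (auto intro: finite_residuals_Int)
qed

lemma finite_residuals_vimage_map:
  assumes "finite_residuals W"
  shows "finite_residuals (map h -` W)"
proof (rule finite_residuals_subset)
  show "finite ((\<lambda>Z. map h -` Z) ` range (residual W))"
    using assms by (simp add: finite_residuals_def)
  fix w
  have "residual (map h -` W) w = map h -` residual W (map h w)" by (auto simp: residual_def)
  then show "residual (map h -` W) w \<in> (\<lambda>Z. map h -` Z) ` range (residual W)" by blast
qed

text \<open>Subset construction: a residual of the image is determined by the set of residuals of
  all preimages of the word read, and there are finitely many such sets.\<close>

lemma finite_residuals_image_map:
  assumes "finite_residuals W"
  shows "finite_residuals (map h ` W)"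
proof (rule finite_residuals_subset)
  show "finite ((\<lambda>Zs. map h ` \<Union> Zs) ` Pow (range (residual W)))"
    using assms by (simp add: finite_residuals_def)
  fix w
  have "residual (map h ` W) w = map h ` \<Union> (residual W ` {v. map h v = w})"
  proof (intro equalityI subsetI)
    fix u assume "u \<in> residual (map h ` W) w"
    then obtain x where "w @ u = map h x" "x \<in> W" by (auto simp: residual_def)
    then obtain y z where "y @ z \<in> W" "map h y = w" "u = map h z"
      by (auto simp: append_eq_map_conv)
    then show "u \<in> map h ` \<Union> (residual W ` {v. map h v = w})" by (auto simp: residual_def)
  next
    fix u assume "u \<in> map h ` \<Union> (residual W ` {v. map h v = w})"
    then obtain y z where "y @ z \<in> W" "map h y = w" "u = map h z" by (auto simp: residual_def)
    then have "w @ u = map h (y @ z)" "y @ z \<in> W" by simp_all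
    then show "u \<in> residual (map h ` W) w" unfolding residual_def by blast
  qed
  moreover have "residual W ` {v. map h v = w} \<in> Pow (range (residual W))" by auto
  ultimately show "residual (map h ` W) w \<in> (\<lambda>Zs. map h ` \<Union> Zs) ` Pow (range (residual W))"
    by blast
qed

text \<open>Residuals cut at the front and the quotient cuts at the back, so the two operations
  commute.\<close>

lemma finite_residuals_right_quotient:
  assumes "finite_residuals W"
  shows "finite_residuals {u. \<exists>v\<in>V. u @ v \<in> W}"
proof (rule finite_residuals_subset)
  show "finite ((\<lambda>Z. {u. \<exists>v\<in>V. u @ v \<in> Z}) ` range (residual W))"
    using assms by (simp add: finite_residuals_def)
  fix w
  have "residual {u. \<exists>v\<in>V. u @ v \<in> W} w = {u. \<exists>v\<in>V. u @ v \<in> residual W w}"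
    by (auto simp: residual_def)
  then show "residual {u. \<exists>v\<in>V. u @ v \<in> W} w
      \<in> (\<lambda>Z. {u. \<exists>v\<in>V. u @ v \<in> Z}) ` range (residual W)" by blast
qed

text \<open>One bit about the word read is enough: after a final \<open>b\<close>, stopping is not
  allowed.\<close>

lemma finite_residuals_last_neq: "finite_residuals {u. u = [] \<or> last u \<noteq> b}"
proof (rule finite_residuals_subset)
  let ?Z = "{{u. u = [] \<or> last u \<noteq> b}, {u. u \<noteq> [] \<and> last u \<noteq> b}}"
  show "finite ?Z" by simp
  show "residual {u. u = [] \<or> last u \<noteq> b} w \<in> ?Z" for w
    by (cases "w = [] \<or> last w \<noteq> b") (auto simp: residual_def last_append)
qed

section \<open>Trailing fillers\<close>

definition append_fillers :: "'c \<Rightarrow> 'c list set \<Rightarrow> 'c list set" where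
  "append_fillers b W = {v @ replicate k b | v k. v \<in> W}"

lemma append_fillersI: "v \<in> W \<Longrightarrow> v @ replicate k b \<in> append_fillers b W"
  by (auto simp: append_fillers_def)

lemma append_fillersE:
  assumes "u \<in> append_fillers b W"
  obtains v k where "v \<in> W" and "u = v @ replicate k b"
  using assms by (auto simp: append_fillers_def)

lemma append_eq_append_replicateE:
  assumes "w @ u = v @ replicate k b"
  obtains z where "w @ z = v" and "u = z @ replicate k b"
    | l m where "w = v @ replicate l b" and "u = replicate m b"
proof -
  obtain z where z: "w @ z = v \<and> u = z @ replicate k b \<or> w = v @ z \<and> z @ u = replicate k b"
    using assms unfolding append_eq_append_conv2 by blast
  show thesis
  proof (cases "w @ z = v \<and> u = z @ replicate k b")
    case True
    then show thesis using that(1) by blast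
  next
    case False
    then have w: "w = v @ z" and zu: "z @ u = replicate k b" using z by auto
    have "\<forall>x\<in>set (z @ u). x = b" unfolding zu by simp
    then have "replicate (length z) b = z" "replicate (length u) b = u"
      by (auto intro: replicate_length_same)
    then show thesis using that(2)[of "length z" "length u"] w by simp
  qed
qed

text \<open>The cut after \<open>w\<close> falls either inside the part from \<open>W\<close> or
  inside the tail of fillers. A residual is thus fixed by a residual of \<open>W\<close> and one
  bit, which gives finiteness.\<close>

lemma residual_append_fillers:
  "residual (append_fillers b W) w = append_fillers b (residual W w) \<union>
    (if w \<in> append_fillers b W then range (\<lambda>k. replicate k b) else {})" (is "_ = ?R")
proof (intro equalityI subsetI)
  fix u assume "u \<in> residual (append_fillers b W) w"
  then have "w @ u \<in> append_fillers b W" by (simp add: residual_def)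
  then obtain v k where v: "v \<in> W" and vk: "w @ u = v @ replicate k b"
    by (rule append_fillersE)
  from vk show "u \<in> ?R"
  proof (cases rule: append_eq_append_replicateE)
    case (1 z)
    then have "z \<in> residual W w" using v by (simp add: residual_def)
    then show ?thesis unfolding 1(2) by (intro UnI1 append_fillersI)
  next
    case (2 l m)
    have "w \<in> append_fillers b W" unfolding 2(1) using v by (rule append_fillersI)
    then show ?thesis using 2(2) by simp
  qed
next
  fix u assume "u \<in> ?R"
  then consider "u \<in> append_fillers b (residual W w)"
    | "w \<in> append_fillers b W" "u \<in> range (\<lambda>k. replicate k b)"
    by (cases "w \<in> append_fillers b W") (simp_all, blast)
  then have "w @ u \<in> append_fillers b W"
  proof cases
    case 1
    then obtain v k where "v \<in> residual W w" "u = v @ replicate k b" by (rule append_fillersE)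
    then show ?thesis using append_fillersI[of "w @ v"] by (simp add: residual_def)
  next
    case 2
    obtain v l where v: "v \<in> W" "w = v @ replicate l b" using 2(1) by (rule append_fillersE)
    moreover obtain k where "u = replicate k b" using 2(2) by blast
    ultimately have "w @ u = v @ replicate (l + k) b" by (simp add: replicate_add)
    then show ?thesis using append_fillersI[OF v(1)] by simp
  qed
  then show "u \<in> residual (append_fillers b W) w" by (simp add: residual_def)
qed

lemma finite_residuals_append_fillers:
  assumes "finite_residuals W"
  shows "finite_residuals (append_fillers b W)"
proof (rule finite_residuals_subset)
  let ?G = "\<lambda>(Z, Y). append_fillers b Z \<union> Y"
  let ?P = "range (residual W) \<times> {{}, range (\<lambda>k. replicate k b)}"
  show "finite (?G ` ?P)" using assms by (simp add: finite_residuals_def)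
  show "residual (append_fillers b W) w \<in> ?G ` ?P" for w
    unfolding residual_append_fillers
    by (rule image_eqI[of _ _ "(residual W w,
        if w \<in> append_fillers b W then range (\<lambda>k. replicate k b) else {})"]) auto
qed

section \<open>Paddings of a convolution to arbitrary length\<close>

definition letter :: "'s list list \<Rightarrow> nat \<Rightarrow> 's option list" where
  "letter ws i = map (\<lambda>w. if i < length w then Some (w ! i) else None) ws"

text \<open>The length is free, and \<open>N = height ws\<close> gives the convolution. A smaller
  \<open>N\<close> would truncate strings, hence the side condition \<open>height ws \<le> N\<close>
  wherever the tuple has to be recovered.\<close>

definition pad :: "nat \<Rightarrow> 's list list \<Rightarrow> 's option list list" where
  "pad N ws = map (letter ws) [0..<N]"

definition height :: "'s list list \<Rightarrow> nat" where
  "height ws = Max (insert 0 (length ` set ws))"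

definition padded :: "'s list list set \<Rightarrow> 's option list list set" where
  "padded S = {pad N ws | N ws. ws \<in> S \<and> height ws \<le> N}"

lemma convolution_eq_pad: "convolution ws = pad (height ws) ws"
  by (simp add: convolution_def pad_def letter_def[abs_def] height_def)

lemma height_le_iff: "height ws \<le> N \<longleftrightarrow> (\<forall>w\<in>set ws. length w \<le> N)"
  by (auto simp: height_def)

lemma height_mono: "set vs \<subseteq> set ws \<Longrightarrow> height vs \<le> height ws"
  using height_le_iff[of ws "height ws"] by (auto simp: height_le_iff)

lemma less_height_iff: "i < height ws \<longleftrightarrow> (\<exists>w\<in>set ws. i < length w)"
  using height_le_iff[of ws i] by (auto simp: not_le[symmetric])

lemma length_pad [simp]: "length (pad N ws) = N"
  by (simp add: pad_def)

lemma letter_eq_filler_iff: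
  assumes "length ws = n"
  shows "letter ws i = replicate n None \<longleftrightarrow> height ws \<le> i"
proof -
  have "letter ws i = replicate n None \<longleftrightarrow> letter ws i = map (\<lambda>_. None) ws"
    using assms by (simp add: map_replicate_const)
  then show ?thesis unfolding letter_def map_eq_conv height_le_iff by auto
qed

lemma pad_eq_convolution_append:
  assumes "length ws = n" and "height ws \<le> N"
  shows "pad N ws = convolution ws @ replicate (N - height ws) (replicate n None)"
proof -
  have "[0..<N] = [0..<height ws] @ [height ws..<N]"
    using assms(2) upt_add_eq_append[of 0 "height ws" "N - height ws"] by simp
  moreover have "map (letter ws) [height ws..<N] = map (\<lambda>_. replicate n None) [height ws..<N]"
    using letter_eq_filler_iff[OF assms(1)] by (intro map_cong) simp_all
  ultimately show ?thesis by (simp add: pad_def convolution_eq_pad map_replicate_const)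
qed

text \<open>The height is attained, so some string still has a letter in the last column.\<close>

lemma last_convolution:
  assumes "length ws = n"
  shows "convolution ws = [] \<or> last (convolution ws) \<noteq> replicate n None"
proof (cases "height ws")
  case 0
  then show ?thesis by (simp add: convolution_eq_pad pad_def)
next
  case (Suc h)
  then have "last (convolution ws) = letter ws h" by (simp add: convolution_eq_pad pad_def)
  then show ?thesis using letter_eq_filler_iff[OF assms, of h] Suc by simp
qed

text \<open>If the lengths differed, then at the position given by the shorter length one string
  would show a filler and the other a letter; the bounds by \<open>N\<close> put that position in
  the range compared.\<close>

lemma symbol_inject:
  assumes "\<And>i. i < N \<Longrightarrow>
      (if i < length v then Some (v ! i) else None) = (if i < length w then Some (w ! i) else None)"
    and "length v \<le> N" and "length w \<le> N"
  shows "v = w"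
proof -
  have "length v = length w"
    using assms(1)[of "length v"] assms(1)[of "length w"] assms(2,3)
    by (cases "length v" "length w" rule: linorder_cases) (auto split: if_splits)
  then show ?thesis
  proof (rule nth_equalityI)
    fix i assume "i < length v"
    then show "v ! i = w ! i" using assms(1)[of i] assms(2) \<open>length v = length w\<close> by simp
  qed
qed

lemma pad_inject:
  assumes "pad N vs = pad M ws" and "length vs = length ws"
    and "height vs \<le> N" and "height ws \<le> M"
  shows "vs = ws"
proof (rule nth_equalityI[OF assms(2)])
  have "N = M" using assms(1) by (metis length_pad)
  fix j assume j: "j < length vs"
  show "vs ! j = ws ! j"
  proof (rule symbol_inject)
    fix i assume "i < N"
    then have "letter vs i ! j = letter ws i ! j"
      using assms(1) \<open>N = M\<close> by (simp add: pad_def)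
    then show "(if i < length (vs ! j) then Some (vs ! j ! i) else None)
        = (if i < length (ws ! j) then Some (ws ! j ! i) else None)"
      using j assms(2) by (simp add: letter_def)
  qed (use j assms(2-4) \<open>N = M\<close> in \<open>auto simp: height_le_iff\<close>)
qed

text \<open>Transfers what is known about convolutions, the form in which presentations are given,
  to paddings: beyond the height only columns of fillers are added.\<close>

lemma padded_eq_append_fillers:
  assumes "\<And>ws. ws \<in> S \<Longrightarrow> length ws = n"
  shows "padded S = append_fillers (replicate n None) (convolution ` S)"
proof (intro equalityI subsetI)
  fix u assume "u \<in> padded S"
  then obtain N ws where ws: "ws \<in> S" "height ws \<le> N" "u = pad N ws"
    unfolding padded_def by blast
  then show "u \<in> append_fillers (replicate n None) (convolution ` S)"
    unfolding ws(3) pad_eq_convolution_append[OF assms[OF ws(1)] ws(2)]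
    by (intro append_fillersI imageI)
next
  fix u assume "u \<in> append_fillers (replicate n None) (convolution ` S)"
  then obtain ws k where ws: "ws \<in> S" "u = convolution ws @ replicate k (replicate n None)"
    by (auto elim: append_fillersE)
  then have "u = pad (height ws + k) ws"
    using pad_eq_convolution_append[OF assms[OF ws(1)], of "height ws + k"] by simp
  then show "u \<in> padded S" using ws(1) unfolding padded_def by force
qed

lemma fa_recognizable_finite_residuals:
  "fa_recognizable \<Sigma> n S \<Longrightarrow> finite_residuals (convolution ` S)"
  unfolding fa_recognizable_def by (blast intro: regular_language_finite_residuals)

lemma finite_residuals_padded:
  assumes "fa_recognizable \<Sigma> n S"
  shows "finite_residuals (padded S)"
proof -
  have "\<And>ws. ws \<in> S \<Longrightarrow> length ws = n" using assms by (auto simp: fa_recognizable_def)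
  then show ?thesis
    using finite_residuals_append_fillers[OF fa_recognizable_finite_residuals[OF assms]]
    by (simp only: padded_eq_append_fillers)
qed

lemma append_replicate_inject:
  assumes "u @ replicate k b = v @ replicate l b"
    and "u = [] \<or> last u \<noteq> b" and "v = [] \<or> last v \<noteq> b"
  shows "u = v"
proof -
  \<comment> \<open>Stripping \<open>b\<close> from the front of the reversed word undoes the
    padding, whatever the value of \<open>m\<close>.\<close>
  have strip: "dropWhile ((=) b) (rev (w @ replicate m b)) = rev w"
    if "w = [] \<or> last w \<noteq> b" for w m
  proof -
    have "dropWhile ((=) b) (replicate m b @ rev w) = dropWhile ((=) b) (rev w)"
      by (intro dropWhile_append2) auto
    also have "\<dots> = rev w"
      using that by (cases w rule: rev_cases) auto
    finally show ?thesis by simp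
  qed
  show ?thesis using strip[OF assms(2), of k] strip[OF assms(3), of l] assms(1) by simp
qed

lemma convolution_in_lists:
  assumes "length ws = n" and "set ws \<subseteq> lists \<Sigma>"
  shows "convolution ws \<in> lists (conv_alphabet \<Sigma> n)"
proof -
  have "letter ws i \<in> conv_alphabet \<Sigma> n" for i
    using assms by (fastforce simp: conv_alphabet_def letter_def in_lists_conv_set)
  then show ?thesis by (auto simp: convolution_eq_pad pad_def)
qed

lemma finite_conv_alphabet:
  assumes "finite \<Sigma>"
  shows "finite (conv_alphabet \<Sigma> n)"
  using finite_lists_length_eq[of "insert None (Some ` \<Sigma>)" n] assms
  by (simp add: conv_alphabet_def conj_commute)

text \<open>\<open>V\<close> arises by deleting tracks, so it contains a padding of every tuple of \<open>S\<close> but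
  not necessarily its convolution.\<close>

lemma fa_recognizable_if_paddings:
  assumes "finite \<Sigma>" and S: "S \<subseteq> {ws. length ws = n \<and> set ws \<subseteq> lists \<Sigma>}"
    and V: "finite_residuals V"
    and ex: "\<And>ws. ws \<in> S \<Longrightarrow> \<exists>N\<ge>height ws. pad N ws \<in> V"
    and sub: "V \<subseteq> padded S"
  shows "fa_recognizable \<Sigma> n S"
proof -
  let ?b = "replicate n None :: 'a option list"
  \<comment> \<open>The quotient may remove too few fillers; the first factor keeps only words with
    none left at the end.\<close>
  let ?U = "{u. u = [] \<or> last u \<noteq> ?b} \<inter> {u. \<exists>v\<in>range (\<lambda>k. replicate k ?b). u @ v \<in> V}"
  have len: "\<And>ws. ws \<in> S \<Longrightarrow> length ws = n" using S by auto
  have "convolution ` S = ?U"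
  proof (intro equalityI subsetI)
    fix u assume "u \<in> convolution ` S"
    then obtain ws where ws: "ws \<in> S" "u = convolution ws" by blast
    obtain N where "N \<ge> height ws" "pad N ws \<in> V" using ex[OF ws(1)] by blast
    then have "u @ replicate (N - height ws) ?b \<in> V"
      using pad_eq_convolution_append[OF len[OF ws(1)]] ws(2) by simp
    moreover have "u = [] \<or> last u \<noteq> ?b"
      unfolding ws(2) by (rule last_convolution[OF len[OF ws(1)]])
    ultimately show "u \<in> ?U" by blast
  next
    fix u assume u: "u \<in> ?U"
    then obtain k where "u @ replicate k ?b \<in> padded S" using sub by blast
    then have "u @ replicate k ?b \<in> append_fillers ?b (convolution ` S)"
      using padded_eq_append_fillers[of S n] len by simp
    then obtain ws l where "ws \<in> S" "u @ replicate k ?b = convolution ws @ replicate l ?b"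
      by (blast elim: append_fillersE)
    moreover have "u = [] \<or> last u \<noteq> ?b" using u by blast
    ultimately have "u = convolution ws"
      using append_replicate_inject last_convolution[OF len[OF \<open>ws \<in> S\<close>]] by metis
    then show "u \<in> convolution ` S" using \<open>ws \<in> S\<close> by simp
  qed
  then have "finite_residuals (convolution ` S)"
    using finite_residuals_Int[OF finite_residuals_last_neq finite_residuals_right_quotient[OF V]]
    by (simp only:)
  moreover have "convolution ` S \<subseteq> lists (conv_alphabet \<Sigma> n)"
    using convolution_in_lists S by blast
  ultimately show ?thesis
    using assms(1) S finite_residuals_regular_language[OF finite_conv_alphabet] by (auto simp: fa_recognizable_def)
qed

section \<open>Relations defined by conditions on selected tracks\<close>

text \<open>A word of columns of length \<open>n\<close> is a padding exactly if no letter follows a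
  filler on any track. For each track this is the preimage of one fixed language under a
  projection.\<close>

lemma finite_residuals_padded_all: "finite_residuals (padded {ws. length ws = n})"
proof -
  let ?C = "{c :: 'a option list. length c = n}"
  let ?B = "append_fillers None (lists (range (Some :: 'a \<Rightarrow> _)))"
  let ?W = "lists ?C \<inter> (\<Inter>j\<in>{..<n}. map (\<lambda>c. c ! j) -` ?B)"
  have "padded {ws. length ws = n} = ?W"
  proof (intro equalityI subsetI)
    fix u :: "'a option list list" assume "u \<in> padded {ws. length ws = n}"
    then obtain N ws where u: "u = pad N ws" "length ws = n" "height ws \<le> N"
      by (auto simp: padded_def)
    have "map (\<lambda>c. c ! j) u \<in> ?B" if j: "j < n" for j
    proof -
      have l: "length (ws ! j) \<le> N" using u j by (auto simp: height_le_iff)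
      have "map (\<lambda>c. c ! j) u
          = map Some (ws ! j) @ replicate (N - length (ws ! j)) None"
        using l u j by (intro nth_equalityI) (auto simp: pad_def letter_def nth_append)
      moreover have "map Some (ws ! j) \<in> lists (range Some)" by auto
      ultimately show ?thesis by (simp only: append_fillersI)
    qed
    moreover have "u \<in> lists ?C" using u by (auto simp: pad_def letter_def)
    ultimately show "u \<in> ?W" by simp
  next
    fix u assume u: "u \<in> ?W"
    have "\<exists>w k. map (\<lambda>c. c ! j) u = map Some w @ replicate k None" if "j < n" for j
    proof -
      have "map (\<lambda>c. c ! j) u \<in> ?B" using u that by simp
      then obtain v k where vk: "map (\<lambda>c. c ! j) u = v @ replicate k None"
        "v \<in> lists (range (Some :: 'a \<Rightarrow> _))"
        by (rule append_fillersE)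
      from vk(2) have "v = map Some (map the v)" by (induction v) auto
      then show ?thesis using vk(1) by metis
    qed
    then obtain w k where
      wk: "\<And>j. j < n \<Longrightarrow> map (\<lambda>c. c ! j) u = map Some (w j) @ replicate (k j) None"
      by metis
    let ?ws = "map w [0..<n]"
    have len: "length u = length (w j) + k j" if "j < n" for j
      using arg_cong[OF wk[OF that], of length] by simp
    have "height ?ws \<le> length u" by (auto simp: height_le_iff len)
    moreover have "u = pad (length u) ?ws"
    proof (rule nth_equalityI)
      fix i assume i: "i < length u"
      have "u ! i = letter ?ws i"
      proof (rule nth_equalityI)
        have "u ! i \<in> ?C" using u i by (auto simp: in_lists_conv_set)
        then show "length (u ! i) = length (letter ?ws i)" by (simp add: letter_def)
        fix j assume "j < length (u ! i)"
        then have j: "j < n" using \<open>u ! i \<in> ?C\<close> by simp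
        have "u ! i ! j = (map Some (w j) @ replicate (k j) None) ! i"
          using wk[OF j] i by (metis nth_map)
        then show "u ! i ! j = letter ?ws i ! j"
          using i j len[OF j] by (simp add: letter_def nth_append)
      qed
      then show "u ! i = pad (length u) ?ws ! i" using i by (simp add: pad_def)
    qed simp
    ultimately show "u \<in> padded {ws. length ws = n}" by (force simp: padded_def)
  qed
  moreover have "finite_residuals ?W"
    by (intro finite_residuals_Int finite_residuals_INT finite_residuals_vimage_map
        finite_residuals_append_fillers finite_residuals_lists) simp
  ultimately show ?thesis by simp
qed

text \<open>Imposes a given relation on the tracks \<open>js\<close>, in any order and with
  repetitions. Selection acts column by column, so the result is a preimage; intersecting with all
  paddings is needed because the preimage says nothing about the tracks outside
  \<open>js\<close>.\<close>

lemma finite_residuals_padded_reindex: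
  assumes "finite_residuals (padded S)" and "\<And>us. us \<in> S \<Longrightarrow> length us = length js"
    and js: "set js \<subseteq> {..<n}"
  shows "finite_residuals (padded {ws. length ws = n \<and> map ((!) ws) js \<in> S})"
proof -
  let ?h = "\<lambda>c. map ((!) c) js"
  have pad: "map ?h (pad N ws) = pad N (map ((!) ws) js)" if "length ws = n" for N ws
    using that js by (auto simp: pad_def letter_def)
  have height: "height (map ((!) ws) js) \<le> height ws" if "length ws = n" for ws
    using that js by (intro height_mono) auto
  have "padded {ws. length ws = n \<and> map ((!) ws) js \<in> S}
      = padded {ws. length ws = n} \<inter> (map ?h -` padded S)"
  proof (intro equalityI subsetI)
    fix u assume "u \<in> padded {ws. length ws = n \<and> map ((!) ws) js \<in> S}"
    then obtain N ws where u: "u = pad N ws" "height ws \<le> N"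
      and ws: "length ws = n" "map ((!) ws) js \<in> S"
      unfolding padded_def by blast
    have "map ?h u = pad N (map ((!) ws) js)" unfolding u(1) by (rule pad[OF ws(1)])
    moreover have "height (map ((!) ws) js) \<le> N" using height[OF ws(1)] u(2) by simp
    ultimately have "map ?h u \<in> padded S" using ws(2) unfolding padded_def by blast
    then show "u \<in> padded {ws. length ws = n} \<inter> (map ?h -` padded S)"
      using u ws(1) unfolding padded_def by blast
  next
    fix u assume "u \<in> padded {ws. length ws = n} \<inter> (map ?h -` padded S)"
    then obtain N ws where u: "u = pad N ws" "length ws = n" "height ws \<le> N"
      and "map ?h u \<in> padded S"
      by (auto simp: padded_def)
    then obtain M us where us: "pad N (map ((!) ws) js) = pad M us" "us \<in> S" "height us \<le> M"
      using pad[OF u(2)] by (auto simp: padded_def)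
    have "map ((!) ws) js = us"
      using u us assms(2) height[OF u(2)] by (intro pad_inject[OF us(1)]) auto
    then show "u \<in> padded {ws. length ws = n \<and> map ((!) ws) js \<in> S}"
      using u us(2) by (auto simp: padded_def)
  qed
  then show ?thesis
    using finite_residuals_Int[OF finite_residuals_padded_all
        finite_residuals_vimage_map[OF assms(1)]]
    by (simp only:)
qed

lemma padded_mono: "S \<subseteq> T \<Longrightarrow> padded S \<subseteq> padded T"
  unfolding padded_def by blast

text \<open>By injectivity of padding, a word in both languages comes from one and the same
  tuple.\<close>

lemma padded_Int:
  assumes "\<And>ws. ws \<in> S \<Longrightarrow> length ws = n" and "\<And>ws. ws \<in> T \<Longrightarrow> length ws = n"
  shows "padded (S \<inter> T) = padded S \<inter> padded T"
proof (intro equalityI subsetI)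
  fix u assume "u \<in> padded S \<inter> padded T"
  then obtain N vs M ws where vs: "u = pad N vs" "vs \<in> S" "height vs \<le> N"
    and ws: "u = pad M ws" "ws \<in> T" "height ws \<le> M"
    unfolding padded_def by blast
  have "vs = ws"
    using vs ws assms by (intro pad_inject[of N vs M ws]) simp_all
  then show "u \<in> padded (S \<inter> T)" using vs ws(2) unfolding padded_def by blast
qed (use padded_mono[of "S \<inter> T"] in blast)

text \<open>The form with predicates lets a conjunction of conditions on tracks be split until each
  conjunct is a reindexed relation.\<close>

lemma finite_residuals_padded_conj:
  assumes "finite_residuals (padded {ws. length ws = n \<and> P ws})"
    and "finite_residuals (padded {ws. length ws = n \<and> R ws})"
  shows "finite_residuals (padded {ws. length ws = n \<and> P ws \<and> R ws})"
proof -
  have "{ws. length ws = n \<and> P ws \<and> R ws}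
      = {ws. length ws = n \<and> P ws} \<inter> {ws. length ws = n \<and> R ws}" by blast
  moreover have "padded ({ws. length ws = n \<and> P ws} \<inter> {ws. length ws = n \<and> R ws})
      = padded {ws. length ws = n \<and> P ws} \<inter> padded {ws. length ws = n \<and> R ws}"
    by (rule padded_Int[of _ n]) blast+
  ultimately show ?thesis using finite_residuals_Int[OF assms] by (simp only:)
qed

section \<open>Coding a tuple of strings as one string\<close>

text \<open>Each column of the convolution becomes a single letter. The map \<open>enc\<close>
  renames columns, since the final alphabet has to consist of natural numbers.\<close>

definition block_code :: "('s option list \<Rightarrow> 't) \<Rightarrow> 's list list \<Rightarrow> 't list" where
  "block_code enc vs = map enc (convolution vs)"

lemma length_block_code [simp]: "length (block_code enc vs) = height vs"
  by (simp add: block_code_def convolution_eq_pad)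

lemma block_code_in_lists:
  assumes "length vs = k" and "set vs \<subseteq> lists \<Sigma>"
  shows "block_code enc vs \<in> lists (enc ` conv_alphabet \<Sigma> k)"
  using convolution_in_lists[OF assms] by (auto simp: block_code_def)

text \<open>\<open>enc\<close> can be undone on the columns that occur, and a convolution determines
  its tuple because padding to the height loses nothing.\<close>

lemma block_code_inject:
  assumes "inj_on enc (conv_alphabet \<Sigma> k)" and "block_code enc vs = block_code enc ws"
    and "length vs = k" "set vs \<subseteq> lists \<Sigma>" and "length ws = k" "set ws \<subseteq> lists \<Sigma>"
  shows "vs = ws"
proof -
  have "set (convolution vs) \<union> set (convolution ws) \<subseteq> conv_alphabet \<Sigma> k"
    using convolution_in_lists[OF assms(3,4)] convolution_in_lists[OF assms(5,6)] by auto
  then have "convolution vs = convolution ws"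
    by (intro map_inj_on[OF assms(2)[unfolded block_code_def]] inj_on_subset[OF assms(1)])
  then have "pad (height vs) vs = pad (height ws) ws" by (simp only: convolution_eq_pad)
  then show ?thesis by (rule pad_inject) (simp_all add: assms(3,5))
qed

text \<open>Each list in \<open>jss\<close> names the tracks merged into one coded string. A track
  in no list is deleted, which amounts to existential quantification over it.\<close>

lemma fa_recognizable_block_code:
  assumes "finite \<Sigma>" and R: "R \<subseteq> {ws. length ws = n}" "finite_residuals (padded R)"
    and jss: "\<And>js. js \<in> set jss \<Longrightarrow> length js = k \<and> set js \<subseteq> {..<n}"
    and \<Sigma>: "\<And>ws js j. ws \<in> R \<Longrightarrow> js \<in> set jss \<Longrightarrow> j \<in> set js \<Longrightarrow> ws ! j \<in> lists \<Sigma>"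
  shows "fa_recognizable (enc ` conv_alphabet \<Sigma> k) (length jss)
    ((\<lambda>ws. map (\<lambda>js. block_code enc (map ((!) ws) js)) jss) ` R)"
proof -
  define code where "code ws = map (\<lambda>js. block_code enc (map ((!) ws) js)) jss" for ws
  \<comment> \<open>The recoding as a map on single columns. A coded string is as long as the
    longest string of its block, so it has a filler only where the whole block has fillers.\<close>
  define g where "g c = map (\<lambda>js. if \<forall>j\<in>set js. c ! j = None then None
      else Some (enc (map ((!) c) js))) jss" for c
  have height: "height (code ws) \<le> height ws" if "ws \<in> R" for ws
  proof -
    have "height (map ((!) ws) js) \<le> height ws" if "js \<in> set jss" for js
    proof (rule height_mono)
      have "set js \<subseteq> {..<length ws}" using jss[OF that] R(1) \<open>ws \<in> R\<close> by blast
      then show "set (map ((!) ws) js) \<subseteq> set ws" by auto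
    qed
    then show ?thesis unfolding height_le_iff[of "code ws"] by (simp add: code_def)
  qed
  have letter: "g (letter ws i) = letter (code ws) i" if "ws \<in> R" for ws i
  proof -
    have "(if \<forall>j\<in>set js. letter ws i ! j = None then None
          else Some (enc (map ((!) (letter ws i)) js)))
        = (if i < length (block_code enc (map ((!) ws) js))
            then Some (block_code enc (map ((!) ws) js) ! i) else None)"
      if js: "js \<in> set jss" for js
    proof -
      have sub: "j < length ws" if "j \<in> set js" for j
        using that jss[OF js] \<open>ws \<in> R\<close> R(1) by auto
      then have l: "map ((!) (letter ws i)) js = letter (map ((!) ws) js) i"
        by (auto simp: letter_def)
      have "(\<forall>j\<in>set js. letter ws i ! j = None) \<longleftrightarrow> \<not> i < height (map ((!) ws) js)"
        using sub by (auto simp: less_height_iff letter_def)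
      then show ?thesis unfolding l
        by (auto simp: block_code_def convolution_eq_pad pad_def)
    qed
    then show ?thesis unfolding g_def code_def letter_def[of "map _ _"] map_map o_def
      by (intro map_cong refl)
  qed
  have pad: "map g (pad N ws) = pad N (code ws)" if "ws \<in> R" for N ws
    using letter[OF that] by (simp add: pad_def)
  have "fa_recognizable (enc ` conv_alphabet \<Sigma> k) (length jss) (code ` R)"
  proof (rule fa_recognizable_if_paddings)
    show "finite (enc ` conv_alphabet \<Sigma> k)" using finite_conv_alphabet[OF \<open>finite \<Sigma>\<close>] by simp
    have "block_code enc (map ((!) ws) js) \<in> lists (enc ` conv_alphabet \<Sigma> k)"
      if "ws \<in> R" "js \<in> set jss" for ws js
    proof (rule block_code_in_lists)
      show "length (map ((!) ws) js) = k" using jss[OF that(2)] by simp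
      show "set (map ((!) ws) js) \<subseteq> lists \<Sigma>" using \<Sigma>[OF that] unfolding set_map by (rule image_subsetI)
    qed
    then have "set (code ws) \<subseteq> lists (enc ` conv_alphabet \<Sigma> k)" if "ws \<in> R" for ws
      unfolding code_def set_map using that by (intro image_subsetI)
    then show "code ` R
        \<subseteq> {ws. length ws = length jss \<and> set ws \<subseteq> lists (enc ` conv_alphabet \<Sigma> k)}"
      by (intro image_subsetI) (simp add: code_def)
    show "finite_residuals (map g ` padded R)"
      by (rule finite_residuals_image_map[OF R(2)])
    show "\<exists>N\<ge>height xs. pad N xs \<in> map g ` padded R" if xs: "xs \<in> code ` R" for xs
    proof -
      obtain ws where ws: "ws \<in> R" "xs = code ws" using xs by blast
      \<comment> \<open>The length is the height of the full tuple; if a deleted track was the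
        longest, it exceeds \<open>height xs\<close>, and trailing fillers remain.\<close>
      then have "pad (height ws) ws \<in> padded R" unfolding padded_def by blast
      then have "pad (height ws) xs \<in> map g ` padded R"
        unfolding ws(2) pad[OF ws(1), symmetric] by (rule imageI)
      then show ?thesis using height[OF ws(1)] ws(2) by blast
    qed
    show "map g ` padded R \<subseteq> padded (code ` R)"
    proof
      fix u assume "u \<in> map g ` padded R"
      then obtain N ws where ws: "ws \<in> R" "height ws \<le> N" and "u = map g (pad N ws)"
        unfolding padded_def by blast
      then have "u = pad N (code ws)" using pad[OF ws(1)] by simp
      moreover have "height (code ws) \<le> N" using height[OF ws(1)] ws(2) by (rule order_trans)
      ultimately show "u \<in> padded (code ` R)" using ws(1) unfolding padded_def by blast
    qed
  qed
  then show ?thesis unfolding code_def .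
qed

section \<open>Arithmetic in a central extension described by a cocycle\<close>

lemma (in group_hom) coset_representative_factorization:
  assumes "\<And>q. q \<in> carrier H \<Longrightarrow> r q \<in> carrier G \<and> h (r q) = q" and "x \<in> carrier G"
  shows "\<exists>z\<in>kernel G H h. x = r (h x) \<otimes>\<^bsub>G\<^esub> z"
proof -
  have r: "r (h x) \<in> carrier G" "h (r (h x)) = h x" using assms by auto
  have "inv\<^bsub>G\<^esub> (r (h x)) \<otimes>\<^bsub>G\<^esub> x \<in> kernel G H h"
    using r assms(2) by (simp add: kernel_def)
  moreover have "x = r (h x) \<otimes>\<^bsub>G\<^esub> (inv\<^bsub>G\<^esub> (r (h x)) \<otimes>\<^bsub>G\<^esub> x)"
    using r assms(2) by (simp add: G.m_assoc[symmetric])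
  ultimately show ?thesis by blast
qed

locale described_central_extension =
  fixes A :: "('a, 'm) monoid_scheme" and L :: "('l, 'n) monoid_scheme"
    and Q :: "('q, 'k) monoid_scheme" and \<iota> \<phi> f r
  assumes extension: "central_extension A L Q \<iota> \<phi>" and cocycle: "cocycle Q A f"
    and representative: "\<And>q. q \<in> carrier Q \<Longrightarrow> r q \<in> carrier L \<and> \<phi> (r q) = q"
    and cocycle_representative: "\<And>p q. p \<in> carrier Q \<Longrightarrow> q \<in> carrier Q \<Longrightarrow>
      \<iota> (f p q) = r p \<otimes>\<^bsub>L\<^esub> r q \<otimes>\<^bsub>L\<^esub> inv\<^bsub>L\<^esub> (r (p \<otimes>\<^bsub>Q\<^esub> q))"
begin

text \<open>The isomorphism from \<open>L_f\<close> to \<open>L\<close>, written on pairs; the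
  lemmas below establish surjectivity, injectivity and the product rule.\<close>

definition element :: "'q \<Rightarrow> 'a \<Rightarrow> 'l" where
  "element q a = r q \<otimes>\<^bsub>L\<^esub> \<iota> a"

sublocale A: group A using extension by (simp add: central_extension_def)
sublocale L: group L using extension by (simp add: central_extension_def)
sublocale Q: group Q using extension by (simp add: central_extension_def)
sublocale inj: group_hom A L \<iota>
  using extension
  by unfold_locales (simp add: central_extension_def mon_def)
sublocale proj: group_hom L Q \<phi>
  using extension
  by unfold_locales (simp add: central_extension_def epi_def)

lemma image_eq_kernel: "\<iota> ` carrier A = kernel L Q \<phi>"
  using extension by (simp add: central_extension_def)

lemma inj_on_carrier: "inj_on \<iota> (carrier A)"
  using extension by (simp add: central_extension_def mon_def)

lemma cocycle_closed: "p \<in> carrier Q \<Longrightarrow> q \<in> carrier Q \<Longrightarrow> f p q \<in> carrier A"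
  using cocycle by (simp add: cocycle_def)

lemma central: "a \<in> carrier A \<Longrightarrow> x \<in> carrier L \<Longrightarrow> \<iota> a \<otimes>\<^bsub>L\<^esub> x = x \<otimes>\<^bsub>L\<^esub> \<iota> a"
  using extension by (auto simp: central_extension_def)

lemma element_closed: "q \<in> carrier Q \<Longrightarrow> a \<in> carrier A \<Longrightarrow> element q a \<in> carrier L"
  using representative by (simp add: element_def)

lemma carrier_eq_elements: "carrier L = {element q a | q a. q \<in> carrier Q \<and> a \<in> carrier A}"
proof (intro equalityI subsetI)
  fix x assume x: "x \<in> carrier L"
  have "\<exists>z\<in>\<iota> ` carrier A. x = r (\<phi> x) \<otimes>\<^bsub>L\<^esub> z"
    unfolding image_eq_kernel using representative x
    by (rule proj.coset_representative_factorization)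
  then obtain a where "a \<in> carrier A" "x = element (\<phi> x) a"
    unfolding element_def by blast
  then show "x \<in> {element q a | q a. q \<in> carrier Q \<and> a \<in> carrier A}"
    using proj.hom_closed[OF x] by blast
qed (auto simp: element_closed)

lemma proj_element:
  assumes "q \<in> carrier Q" and "a \<in> carrier A"
  shows "\<phi> (element q a) = q"
proof -
  have "\<iota> a \<in> kernel L Q \<phi>" unfolding image_eq_kernel[symmetric] using assms(2) by (rule imageI)
  then show ?thesis using representative assms by (simp add: element_def kernel_def)
qed

text \<open>Applying \<phi> recovers the component in \<open>Q\<close>; cancelling the common
  representative leaves injectivity of \<iota>. Equality of coded elements can therefore be tested
  componentwise.\<close>

lemma element_inject:
  assumes "p \<in> carrier Q" "a \<in> carrier A" "q \<in> carrier Q" "b \<in> carrier A"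
  shows "element p a = element q b \<longleftrightarrow> p = q \<and> a = b"
proof
  assume eq: "element p a = element q b"
  then have "p = q" using proj_element assms by metis
  moreover have "\<iota> a = \<iota> b"
    using eq assms representative \<open>p = q\<close> by (simp add: element_def)
  then have "a = b" by (rule inj_onD[OF inj_on_carrier _ assms(2,4)])
  ultimately show "p = q \<and> a = b" by simp
qed simp

text \<open>The central factor \<iota> \<open>a\<close> moves past \<open>r q\<close>, and the
  cocycle replaces \<open>r p\<close> times \<open>r q\<close> by the representative of the product
  times \<iota> \<open>(f p q)\<close>. The bracketing on the right needs just two intermediate
  values in \<open>A\<close>.\<close>

lemma element_mult:
  assumes p: "p \<in> carrier Q" and a: "a \<in> carrier A" and q: "q \<in> carrier Q" and b: "b \<in> carrier A"
  shows "element p a \<otimes>\<^bsub>L\<^esub> element q b = element (p \<otimes>\<^bsub>Q\<^esub> q) (f p q \<otimes>\<^bsub>A\<^esub> (a \<otimes>\<^bsub>A\<^esub> b))"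
proof -
  let ?s = "r (p \<otimes>\<^bsub>Q\<^esub> q)"
  have r: "r p \<in> carrier L" "r q \<in> carrier L" "?s \<in> carrier L"
    using representative p q by auto
  have f: "f p q \<in> carrier A" using cocycle_closed p q .
  have "\<iota> (f p q) \<otimes>\<^bsub>L\<^esub> ?s = r p \<otimes>\<^bsub>L\<^esub> r q"
    using r by (simp add: cocycle_representative[OF p q] L.m_assoc)
  then have s: "r p \<otimes>\<^bsub>L\<^esub> r q = ?s \<otimes>\<^bsub>L\<^esub> \<iota> (f p q)" using central[OF f r(3)] by simp
  have "element p a \<otimes>\<^bsub>L\<^esub> element q b = r p \<otimes>\<^bsub>L\<^esub> (\<iota> a \<otimes>\<^bsub>L\<^esub> r q) \<otimes>\<^bsub>L\<^esub> \<iota> b"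
    using r a b by (simp add: element_def L.m_assoc)
  also have "\<dots> = (r p \<otimes>\<^bsub>L\<^esub> r q) \<otimes>\<^bsub>L\<^esub> (\<iota> a \<otimes>\<^bsub>L\<^esub> \<iota> b)"
    unfolding central[OF a r(2)] using r a b by (simp add: L.m_assoc)
  also have "\<dots> = element (p \<otimes>\<^bsub>Q\<^esub> q) (f p q \<otimes>\<^bsub>A\<^esub> (a \<otimes>\<^bsub>A\<^esub> b))"
    using r a b f by (simp add: s element_def L.m_assoc)
  finally show ?thesis .
qed

end

section \<open>The FA presentation of the extension\<close>

theorem proposition6p1:
  fixes A :: "('a, 'm) monoid_scheme"
    and Q :: "('q, 'k) monoid_scheme"
    and L :: "('l, 'n) monoid_scheme"
    and \<Sigma>\<^sub>A \<Sigma>\<^sub>Q \<Sigma> :: "'s set"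
    and D\<^sub>A D\<^sub>Q :: "'s list set"
    and \<pi>\<^sub>A :: "'s list \<Rightarrow> 'a"
    and \<pi>\<^sub>Q :: "'s list \<Rightarrow> 'q"
    and \<iota> :: "'a \<Rightarrow> 'l"
    and \<phi> :: "'l \<Rightarrow> 'q"
    and f :: "'q \<Rightarrow> 'q \<Rightarrow> 'a"
  assumes "comm_group A" and "comm_group Q"
    and "fa_presentation \<Sigma>\<^sub>A D\<^sub>A \<pi>\<^sub>A A"
    and "fa_presentation \<Sigma>\<^sub>Q D\<^sub>Q \<pi>\<^sub>Q Q"
    and "finite \<Sigma>" and "\<Sigma>\<^sub>A \<subseteq> \<Sigma>" and "\<Sigma>\<^sub>Q \<subseteq> \<Sigma>"
    and "central_extension A L Q \<iota> \<phi>"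
    and "cocycle_describes A L Q \<iota> \<phi> f"
    and "fa_recognizable_cocycle \<Sigma> D\<^sub>Q \<pi>\<^sub>Q D\<^sub>A \<pi>\<^sub>A f"
  shows "word_automatic L"
proof -
  obtain r where "\<And>q. q \<in> carrier Q \<Longrightarrow> r q \<in> carrier L \<and> \<phi> (r q) = q"
    and "\<And>p q. p \<in> carrier Q \<Longrightarrow> q \<in> carrier Q \<Longrightarrow>
      \<iota> (f p q) = r p \<otimes>\<^bsub>L\<^esub> r q \<otimes>\<^bsub>L\<^esub> inv\<^bsub>L\<^esub> (r (p \<otimes>\<^bsub>Q\<^esub> q))"
    using assms(9) unfolding cocycle_describes_def by blast
  then interpret described_central_extension A L Q \<iota> \<phi> f r
    using assms(8,9) by unfold_locales (auto simp: cocycle_describes_def)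
  let ?EQ = "{[\<sigma>, \<tau>] | \<sigma> \<tau>. \<sigma> \<in> D\<^sub>Q \<and> \<tau> \<in> D\<^sub>Q \<and> \<pi>\<^sub>Q \<sigma> = \<pi>\<^sub>Q \<tau>}"
  let ?EA = "{[\<sigma>, \<tau>] | \<sigma> \<tau>. \<sigma> \<in> D\<^sub>A \<and> \<tau> \<in> D\<^sub>A \<and> \<pi>\<^sub>A \<sigma> = \<pi>\<^sub>A \<tau>}"
  let ?MQ = "{[\<sigma>, \<tau>, \<rho>] | \<sigma> \<tau> \<rho>. \<sigma> \<in> D\<^sub>Q \<and> \<tau> \<in> D\<^sub>Q \<and> \<rho> \<in> D\<^sub>Q \<and> \<pi>\<^sub>Q \<sigma> \<otimes>\<^bsub>Q\<^esub> \<pi>\<^sub>Q \<tau> = \<pi>\<^sub>Q \<rho>}"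
  let ?MA = "{[\<sigma>, \<tau>, \<rho>] | \<sigma> \<tau> \<rho>. \<sigma> \<in> D\<^sub>A \<and> \<tau> \<in> D\<^sub>A \<and> \<rho> \<in> D\<^sub>A \<and> \<pi>\<^sub>A \<sigma> \<otimes>\<^bsub>A\<^esub> \<pi>\<^sub>A \<tau> = \<pi>\<^sub>A \<rho>}"
  let ?F = "{[\<sigma>, \<tau>, \<rho>] | \<sigma> \<tau> \<rho>. \<sigma> \<in> D\<^sub>Q \<and> \<tau> \<in> D\<^sub>Q \<and> \<rho> \<in> D\<^sub>A \<and> f (\<pi>\<^sub>Q \<sigma>) (\<pi>\<^sub>Q \<tau>) = \<pi>\<^sub>A \<rho>}"
  have DA: "D\<^sub>A \<subseteq> lists \<Sigma>" and DQ: "D\<^sub>Q \<subseteq> lists \<Sigma>"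
    using assms(3,4,6,7) by (auto simp: fa_presentation_def regular_language_def)
  have set_DA: "x \<in> \<Sigma>" if "\<tau> \<in> D\<^sub>A" "x \<in> set \<tau>" for x \<tau> using DA that by blast
  have set_DQ: "x \<in> \<Sigma>" if "\<sigma> \<in> D\<^sub>Q" "x \<in> set \<sigma>" for x \<sigma> using DQ that by blast
  have \<pi>A: "\<pi>\<^sub>A ` D\<^sub>A = carrier A" and \<pi>Q: "\<pi>\<^sub>Q ` D\<^sub>Q = carrier Q"
    using assms(3,4) by (auto simp: fa_presentation_def)
  have recognizable: "finite_residuals (padded ?EQ)" "finite_residuals (padded ?EA)"
    "finite_residuals (padded ?MQ)" "finite_residuals (padded ?MA)" "finite_residuals (padded ?F)"
    using assms(3,4,10) finite_residuals_padded
    unfolding fa_presentation_def fa_recognizable_cocycle_def by blast+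
  \<comment> \<open>From here on, each of the five given relations can be imposed on any choice of
    tracks.\<close>
  note reindex = recognizable[THEN finite_residuals_padded_reindex]

  have "finite (conv_alphabet \<Sigma> 2)" by (rule finite_conv_alphabet[OF assms(5)])
  then obtain enc :: "'s option list \<Rightarrow> nat" where enc: "inj_on enc (conv_alphabet \<Sigma> 2)"
    using finite_imp_inj_to_nat_seg by metis
  let ?\<Gamma> = "enc ` conv_alphabet \<Sigma> 2"
  let ?code = "\<lambda>\<sigma> \<tau>. block_code enc [\<sigma>, \<tau>]"
  have inj: "inj_on (\<lambda>(\<sigma>, \<tau>). ?code \<sigma> \<tau>) (D\<^sub>Q \<times> D\<^sub>A)"
    using block_code_inject[OF enc] DA DQ by (fastforce intro!: inj_onI)
  define D where "D = {?code \<sigma> \<tau> | \<sigma> \<tau>. \<sigma> \<in> D\<^sub>Q \<and> \<tau> \<in> D\<^sub>A}"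
  have code_in_D: "?code \<sigma> \<tau> \<in> D" if "\<sigma> \<in> D\<^sub>Q" "\<tau> \<in> D\<^sub>A" for \<sigma> \<tau>
    using that unfolding D_def by blast
  \<comment> \<open>Decodes a string to its unique pair in \<open>D\<^sub>Q\<close> and
    \<open>D\<^sub>A\<close>; only the values on \<open>D\<close> matter.\<close>
  define \<pi> where "\<pi> w = (case inv_into (D\<^sub>Q \<times> D\<^sub>A) (\<lambda>(\<sigma>, \<tau>). ?code \<sigma> \<tau>) w of
      (\<sigma>, \<tau>) \<Rightarrow> element (\<pi>\<^sub>Q \<sigma>) (\<pi>\<^sub>A \<tau>))" for w
  have \<pi>: "\<pi> (?code \<sigma> \<tau>) = element (\<pi>\<^sub>Q \<sigma>) (\<pi>\<^sub>A \<tau>)" if "\<sigma> \<in> D\<^sub>Q" "\<tau> \<in> D\<^sub>A" for \<sigma> \<tau>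
    using inv_into_f_f[OF inj, of "(\<sigma>, \<tau>)"] that by (simp add: \<pi>_def)
  have \<pi>Q_closed: "\<pi>\<^sub>Q \<sigma> \<in> carrier Q" if "\<sigma> \<in> D\<^sub>Q" for \<sigma> using \<pi>Q that by blast
  have \<pi>A_closed: "\<pi>\<^sub>A \<tau> \<in> carrier A" if "\<tau> \<in> D\<^sub>A" for \<tau> using \<pi>A that by blast

  have "regular_language ?\<Gamma> D"
  proof -
    \<comment> \<open>Membership in \<open>D\<^sub>Q\<close> or \<open>D\<^sub>A\<close> is
      expressed by the equality relation with the same track used twice.\<close>
    let ?R = "{ws. length ws = 2 \<and> map ((!) ws) [0, 0] \<in> ?EQ \<and> map ((!) ws) [1, 1] \<in> ?EA}"
    have "finite_residuals (padded ?R)"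
      by (intro finite_residuals_padded_conj reindex) auto
    moreover have "?R \<subseteq> {ws. length ws = 2 \<and> set ws \<subseteq> lists \<Sigma>}"
      by (auto simp: length_Suc_conv numeral_2_eq_2 intro: set_DA set_DQ)
    \<comment> \<open>\<open>D\<close> consists of coded convolutions without trailing fillers, so
      the paddings are traded for convolutions before the letters are renamed.\<close>
    ultimately have "fa_recognizable \<Sigma> 2 ?R"
      using assms(5) by (intro fa_recognizable_if_paddings[where V = "padded ?R"])
        (auto simp: padded_def)
    then have "finite_residuals (map enc ` convolution ` ?R)"
      by (intro finite_residuals_image_map fa_recognizable_finite_residuals)
    moreover have "D = map enc ` convolution ` ?R"
    proof -
      have "?R = (\<lambda>(\<sigma>, \<tau>). [\<sigma>, \<tau>]) ` (D\<^sub>Q \<times> D\<^sub>A)"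
        by (force simp: length_Suc_conv numeral_2_eq_2)
      moreover have "D = (\<lambda>(\<sigma>, \<tau>). ?code \<sigma> \<tau>) ` (D\<^sub>Q \<times> D\<^sub>A)"
        unfolding D_def by auto
      ultimately show ?thesis by (simp add: image_image block_code_def case_prod_unfold)
    qed
    moreover have "D \<subseteq> lists ?\<Gamma>"
    proof
      fix w assume "w \<in> D"
      then obtain \<sigma> \<tau> where w: "w = ?code \<sigma> \<tau>" and "\<sigma> \<in> D\<^sub>Q" "\<tau> \<in> D\<^sub>A" unfolding D_def by blast
      then have "set [\<sigma>, \<tau>] \<subseteq> lists \<Sigma>" by (auto intro: set_DA set_DQ)
      then show "w \<in> lists ?\<Gamma>" unfolding w by (intro block_code_in_lists) simp_all
    qed
    ultimately show ?thesis
      using \<open>finite (conv_alphabet \<Sigma> 2)\<close> by (simp add: finite_residuals_regular_language)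
  qed

  moreover have "\<pi> ` D = carrier L"
  proof -
    have "\<pi> ` D = {element (\<pi>\<^sub>Q \<sigma>) (\<pi>\<^sub>A \<tau>) | \<sigma> \<tau>. \<sigma> \<in> D\<^sub>Q \<and> \<tau> \<in> D\<^sub>A}"
      using \<pi> unfolding D_def by (force simp: image_iff)
    then show ?thesis unfolding carrier_eq_elements \<pi>Q[symmetric] \<pi>A[symmetric] by blast
  qed

  moreover have "fa_recognizable ?\<Gamma> 2 {[x, y] | x y. x \<in> D \<and> y \<in> D \<and> \<pi> x = \<pi> y}"
  proof -
    \<comment> \<open>Tracks 0 and 1 carry the first pair, tracks 2 and 3 the second; even tracks
      belong to \<open>Q\<close>, odd ones to \<open>A\<close>.\<close>
    let ?R = "{ws. length ws = 4 \<and> map ((!) ws) [0, 2] \<in> ?EQ \<and> map ((!) ws) [1, 3] \<in> ?EA}"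
    let ?jss = "[[0, 1], [2, 3]] :: nat list list"
    have "finite_residuals (padded ?R)"
      by (intro finite_residuals_padded_conj reindex) auto
    then have "fa_recognizable ?\<Gamma> (length ?jss)
        ((\<lambda>ws. map (\<lambda>js. block_code enc (map ((!) ws) js)) ?jss) ` ?R)"
      using assms(5)
      by (intro fa_recognizable_block_code[where n = 4]) (auto intro: set_DA set_DQ)
    moreover have "(\<lambda>ws. map (\<lambda>js. block_code enc (map ((!) ws) js)) ?jss) ` ?R
        = {[x, y] | x y. x \<in> D \<and> y \<in> D \<and> \<pi> x = \<pi> y}" (is "?C = ?E")
    proof (intro equalityI subsetI)
      fix xs assume "xs \<in> ?C"
      then show "xs \<in> ?E" by (auto simp: code_in_D \<pi>)
    next
      fix xs assume "xs \<in> ?E"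
      then obtain \<sigma> \<tau> \<sigma>' \<tau>' where xs: "xs = [?code \<sigma> \<tau>, ?code \<sigma>' \<tau>']"
        and in_D: "\<sigma> \<in> D\<^sub>Q" "\<tau> \<in> D\<^sub>A" "\<sigma>' \<in> D\<^sub>Q" "\<tau>' \<in> D\<^sub>A"
        and eq: "\<pi> (?code \<sigma> \<tau>) = \<pi> (?code \<sigma>' \<tau>')"
        unfolding D_def by blast
      have "\<pi>\<^sub>Q \<sigma> = \<pi>\<^sub>Q \<sigma>' \<and> \<pi>\<^sub>A \<tau> = \<pi>\<^sub>A \<tau>'"
        using eq in_D by (simp add: \<pi> element_inject \<pi>Q_closed \<pi>A_closed)
      then show "xs \<in> ?C"
        using in_D xs by (intro image_eqI[of _ _ "[\<sigma>, \<tau>, \<sigma>', \<tau>']"]) auto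
    qed
    ultimately show ?thesis by (simp add: numeral_2_eq_2)
  qed

  moreover have "fa_recognizable ?\<Gamma> 3
      {[x, y, z] | x y z. x \<in> D \<and> y \<in> D \<and> z \<in> D \<and> \<pi> x \<otimes>\<^bsub>L\<^esub> \<pi> y = \<pi> z}"
  proof -
    \<comment> \<open>Tracks 6 and 7 hold the witnesses for the value of the cocycle and for the product of the
      central parts.\<close>
    let ?R = "{ws. length ws = 8 \<and> map ((!) ws) [0, 2, 4] \<in> ?MQ \<and> map ((!) ws) [0, 2, 6] \<in> ?F
        \<and> map ((!) ws) [1, 3, 7] \<in> ?MA \<and> map ((!) ws) [6, 7, 5] \<in> ?MA}"
    \<comment> \<open>Tracks 6 and 7 lie in no block, so the recoding quantifies over them
      existentially.\<close>
    let ?jss = "[[0, 1], [2, 3], [4, 5]] :: nat list list"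
    have "finite_residuals (padded ?R)"
      by (intro finite_residuals_padded_conj reindex) auto
    then have "fa_recognizable ?\<Gamma> (length ?jss)
        ((\<lambda>ws. map (\<lambda>js. block_code enc (map ((!) ws) js)) ?jss) ` ?R)"
      using assms(5)
      by (intro fa_recognizable_block_code[where n = 8]) (auto intro: set_DA set_DQ)
    moreover have "(\<lambda>ws. map (\<lambda>js. block_code enc (map ((!) ws) js)) ?jss) ` ?R
        = {[x, y, z] | x y z. x \<in> D \<and> y \<in> D \<and> z \<in> D \<and> \<pi> x \<otimes>\<^bsub>L\<^esub> \<pi> y = \<pi> z}" (is "?C = ?M")
    proof (intro equalityI subsetI)
      fix xs assume "xs \<in> ?C"
      then show "xs \<in> ?M" by (auto simp: code_in_D \<pi> element_mult \<pi>Q_closed \<pi>A_closed)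
    next
      fix xs assume "xs \<in> ?M"
      then obtain \<sigma> \<tau> \<sigma>' \<tau>' \<sigma>'' \<tau>'' where xs: "xs = [?code \<sigma> \<tau>, ?code \<sigma>' \<tau>', ?code \<sigma>'' \<tau>'']"
        and in_D: "\<sigma> \<in> D\<^sub>Q" "\<tau> \<in> D\<^sub>A" "\<sigma>' \<in> D\<^sub>Q" "\<tau>' \<in> D\<^sub>A" "\<sigma>'' \<in> D\<^sub>Q" "\<tau>'' \<in> D\<^sub>A"
        and eq: "\<pi> (?code \<sigma> \<tau>) \<otimes>\<^bsub>L\<^esub> \<pi> (?code \<sigma>' \<tau>') = \<pi> (?code \<sigma>'' \<tau>'')"
        unfolding D_def by blast
      \<comment> \<open>Both intermediate values lie in the carrier of \<open>A\<close>, so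
        surjectivity of \<open>\<pi>\<^sub>A\<close> supplies the strings for tracks 6 and
        7.\<close>
      have "f (\<pi>\<^sub>Q \<sigma>) (\<pi>\<^sub>Q \<sigma>') \<in> \<pi>\<^sub>A ` D\<^sub>A" and "\<pi>\<^sub>A \<tau> \<otimes>\<^bsub>A\<^esub> \<pi>\<^sub>A \<tau>' \<in> \<pi>\<^sub>A ` D\<^sub>A"
        unfolding \<pi>A using in_D by (auto simp: cocycle_closed \<pi>Q_closed \<pi>A_closed)
      then obtain \<alpha> \<beta> where w: "\<alpha> \<in> D\<^sub>A" "f (\<pi>\<^sub>Q \<sigma>) (\<pi>\<^sub>Q \<sigma>') = \<pi>\<^sub>A \<alpha>"
          "\<beta> \<in> D\<^sub>A" "\<pi>\<^sub>A \<tau> \<otimes>\<^bsub>A\<^esub> \<pi>\<^sub>A \<tau>' = \<pi>\<^sub>A \<beta>" by blast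
      \<comment> \<open>The product rule turns \<open>eq\<close> into an equation between two values
        of \<open>element\<close>, which splits into its two components.\<close>
      have "\<pi>\<^sub>Q \<sigma> \<otimes>\<^bsub>Q\<^esub> \<pi>\<^sub>Q \<sigma>' = \<pi>\<^sub>Q \<sigma>'' \<and> \<pi>\<^sub>A \<alpha> \<otimes>\<^bsub>A\<^esub> \<pi>\<^sub>A \<beta> = \<pi>\<^sub>A \<tau>''"
        using eq in_D w
        by (simp add: \<pi> element_mult element_inject \<pi>Q_closed \<pi>A_closed)
      then show "xs \<in> ?C"
        using in_D xs w by (intro image_eqI[of _ _ "[\<sigma>, \<tau>, \<sigma>', \<tau>', \<sigma>'', \<tau>'', \<alpha>, \<beta>]"]) auto
    qed
    ultimately show ?thesis by (simp add: numeral_3_eq_3)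
  qed

  ultimately have "fa_presentation ?\<Gamma> D \<pi> L"
    using \<open>finite (conv_alphabet \<Sigma> 2)\<close> by (simp add: fa_presentation_def)
  then show ?thesis using L.group_axioms unfolding word_automatic_def by blast
qed

end
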